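(* (1) If $\mathfrak{s} < \mathfrak{a}_*$, then there is a saturated MAD family $\mathcal{A} \subseteq [\omega]^{\aleph_0}$. (2) Moreover, if $\mathfrak{s} < \mathfrak{a}_*$, then given any dense $J_* \subseteq [\omega]^{\aleph_0}$ we can demand $\mathcal{A} \subseteq J_*$; that is, there is a saturated MAD family $\mathcal{A} \subseteq J_*$.
   Context: $[\omega]^{\aleph_0}$ is the set of infinite subsets of $\omega$. For $A,B\subseteq\omega$, $A \subseteq^* B$ means that $A \setminus B$ is finite; we then say that $B$ almost contains $A$. Two subsets of $\omega$ are almost disjoint if their intersection is finite. A family $\mathcal{A} \subseteq [\omega]^{\aleph_0}$ is AD if it is infinite and any two distinct members are almost disjoint. It is MAD if it is AD and $\subseteq$-maximal among AD families $\subseteq [\omega]^{\aleph_0}$. For $\mathcal{A} \subseteq [\omega]^{\aleph_0}$, $\mathrm{id}_{\mathcal{A}}$ is the ideal of subsets of $\omega$ generated by $\mathcal{A}$ together with the finite subsets of $\omega$, and $\mathrm{id}^+_{\mathcal{A}} = [\omega]^{\aleph_0} \setminus \mathrm{id}_{\mathcal{A}}$. A MAD family $\mathcal{A}$ is saturated if every $B \in \mathrm{id}^+_{\mathcal{A}}$ almost contains some member of $\mathcal{A}$. $J \subseteq [\omega]^{\aleph_0}$ is dense if for every $B \in [\omega]^{\aleph_0}$ there is $A \in J$ with $A \subseteq B$. $\mathfrak{s}$ is the splitting number: the minimal cardinality of a family $\mathcal{S} \subseteq [\omega]^{\aleph_0}$ such that there is no $B \in [\omega]^{\aleph_0}$ satisfying,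 for every $C \in \mathcal{S}$, $B \subseteq^* C$ or $B \subseteq^* \omega \setminus C$. $\mathfrak{a}_*$ is the minimal cardinal $\kappa$ such that there is a sequence $\langle A_\alpha : \alpha < \kappa + \omega\rangle$ (ordinal sum) of pairwise almost disjoint infinite subsets of $\omega$ for which there is no infinite $B \subseteq \omega$ that is almost disjoint to $A_\alpha$ for every $\alpha < \kappa$ while $B \cap A_{\kappa+n}$ is infinite for infinitely many $n<\omega$. *)

theory Defs
  imports "HOL-Library.Nat_Bijection" Complex_Main
begin

unbundle cardinal_syntax

section \<open>Infinite subsets of \<open>\<omega>\<close>, almost inclusion, almost disjointness\<close>

definition infinite_subsets :: "nat set set"
  where "infinite_subsets = {A. infinite A}"

definition almost_subset :: "nat set \<Rightarrow> nat set \<Rightarrow> bool"  (infix \<open>\<subseteq>*\<close> 50)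
  where "A \<subseteq>* B \<longleftrightarrow> finite (A - B)"

definition almost_disjoint :: "nat set \<Rightarrow> nat set \<Rightarrow> bool"
  where "almost_disjoint A B \<longleftrightarrow> finite (A \<inter> B)"

section \<open>Saturated MAD families\<close>

definition AD :: "nat set set \<Rightarrow> bool"
  where "AD \<A> \<longleftrightarrow> \<A> \<subseteq> infinite_subsets \<and> infinite \<A> \<and> pairwise almost_disjoint \<A>"

definition MAD :: "nat set set \<Rightarrow> bool"
  where "MAD \<A> \<longleftrightarrow> AD \<A> \<and> (\<forall>\<B>. AD \<B> \<and> \<A> \<subseteq> \<B> \<longrightarrow> \<B> = \<A>)"

text \<open>Ideals are not required to be proper.\<close>

definition set_ideal :: "nat set set \<Rightarrow> bool"
  where "set_ideal I \<longleftrightarrow> {} \<in> I \<and> (\<forall>X\<in>I. \<forall>Y\<in>I. X \<union> Y \<in> I) \<and> (\<forall>X\<in>I. \<forall>Y. Y \<subseteq> X \<longrightarrow> Y \<in> I)"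

definition id_ideal :: "nat set set \<Rightarrow> nat set set"
  where "id_ideal \<A> = set_ideal hull (\<A> \<union> {F. finite F})"

definition id_plus :: "nat set set \<Rightarrow> nat set set"
  where "id_plus \<A> = infinite_subsets - id_ideal \<A>"

definition saturated_MAD :: "nat set set \<Rightarrow> bool"
  where "saturated_MAD \<A> \<longleftrightarrow> MAD \<A> \<and> (\<forall>B\<in>id_plus \<A>. \<exists>A\<in>\<A>. A \<subseteq>* B)"

definition dense_family :: "nat set set \<Rightarrow> bool"
  where "dense_family J \<longleftrightarrow> J \<subseteq> infinite_subsets \<and> (\<forall>B\<in>infinite_subsets. \<exists>A\<in>J. A \<subseteq> B)"

section \<open>The cardinals \<open>\<ss>\<close> and \<open>\<aa>\<^sub>*\<close>\<close>

text \<open>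
  Cardinals are represented as cardinal orders, determined up to \<open>=o\<close>.  The constant below is
  meaningful when some cardinal order on the type satisfies \<open>P\<close>.
\<close>

definition least_cardinal :: "('a rel \<Rightarrow> bool) \<Rightarrow> 'a rel"
  where "least_cardinal P =
    (SOME \<kappa>. Card_order \<kappa> \<and> P \<kappa> \<and> (\<forall>\<mu>. Card_order \<mu> \<and> P \<mu> \<longrightarrow> \<kappa> \<le>o \<mu>))"

lemma least_cardinal:
  assumes "Card_order \<nu>" "P \<nu>"
  shows "Card_order (least_cardinal P)" "P (least_cardinal P)"
    and "\<And>\<mu>. Card_order \<mu> \<Longrightarrow> P \<mu> \<Longrightarrow> least_cardinal P \<le>o \<mu>"
proof -
  have "\<exists>\<kappa>\<in>{\<kappa>. Card_order \<kappa> \<and> P \<kappa>}. \<forall>\<mu>\<in>{\<kappa>. Card_order \<kappa> \<and> P \<kappa>}. \<kappa> \<le>o \<mu>"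
    by (rule exists_minim_Card_order) (use assms in auto)
  then have "\<exists>\<kappa>. Card_order \<kappa> \<and> P \<kappa> \<and> (\<forall>\<mu>. Card_order \<mu> \<and> P \<mu> \<longrightarrow> \<kappa> \<le>o \<mu>)"
    by blast
  from someI_ex[OF this, folded least_cardinal_def]
  show "Card_order (least_cardinal P)" "P (least_cardinal P)"
    and "\<And>\<mu>. Card_order \<mu> \<Longrightarrow> P \<mu> \<Longrightarrow> least_cardinal P \<le>o \<mu>"
    by blast+
qed

definition splitting_family :: "nat set set \<Rightarrow> bool"
  where "splitting_family \<S> \<longleftrightarrow> \<S> \<subseteq> infinite_subsets \<and>
    \<not> (\<exists>B\<in>infinite_subsets. \<forall>C\<in>\<S>. B \<subseteq>* C \<or> B \<subseteq>* UNIV - C)"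

definition splitting_number :: "nat set rel"  (\<open>\<ss>\<close>)
  where "\<ss> = least_cardinal (\<lambda>\<kappa>. \<exists>\<S>. splitting_family \<S> \<and> |\<S>| =o \<kappa>)"

text \<open>
  A sequence of length \<open>\<kappa> + \<omega>\<close> is indexed by the disjoint sum of \<open>Field \<kappa>\<close> and \<open>nat\<close>: \<open>Inl \<alpha>\<close> is
  the index \<open>\<alpha> < \<kappa>\<close>, and \<open>Inr n\<close> is the index \<open>\<kappa> + n\<close>.
\<close>

definition a_star_sequence :: "'i rel \<Rightarrow> ('i + nat \<Rightarrow> nat set) \<Rightarrow> bool"
  where "a_star_sequence \<kappa> A \<longleftrightarrow>
    (\<forall>i \<in> Field \<kappa> <+> UNIV. A i \<in> infinite_subsets) \<and>
    pairwise (\<lambda>i j. almost_disjoint (A i) (A j)) (Field \<kappa> <+> UNIV) \<and>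
    \<not> (\<exists>B\<in>infinite_subsets. (\<forall>\<alpha>\<in>Field \<kappa>. almost_disjoint B (A (Inl \<alpha>))) \<and>
        infinite {n. infinite (B \<inter> A (Inr n))})"

text \<open>
  Cardinal orders on \<open>nat set\<close> suffice, since the members of such a sequence are distinct sets; see
  \<open>a_star_le\<close> below.
\<close>

definition a_star :: "nat set rel"  (\<open>\<aa>\<^sub>*\<close>)
  where "\<aa>\<^sub>* = least_cardinal (\<lambda>\<kappa>. \<exists>A. a_star_sequence \<kappa> A)"

subsection \<open>Both cardinals exist\<close>

lemma infinite_split:
  fixes B :: "nat set"
  assumes "infinite B"
  obtains C where "infinite (B \<inter> C)" "infinite (B - C)"
proof -
  obtain f :: "nat \<Rightarrow> nat" where f: "inj f" "range f \<subseteq> B"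
    using infinite_countable_subset[OF assms] by blast
  have "infinite (f ` range (\<lambda>n. 2 * n))" "infinite (f ` range (\<lambda>n. 2 * n + 1))"
    using f(1) by (auto simp: image_image inj_def infinite_UNIV_nat dest!: finite_imageD
        intro!: inj_onI) (metis Suc_inject nat_mult_eq_cancel_disj zero_neq_numeral)+
  moreover have "f ` range (\<lambda>n. 2 * n) \<subseteq> B \<inter> f ` range (\<lambda>n. 2 * n)"
    using f(2) by blast
  moreover have "f (2 * n + 1) \<noteq> f (2 * m)" for m n
    using f(1) by (metis Suc_eq_plus1 double_not_eq_Suc_double injD)
  then have "f ` range (\<lambda>n. 2 * n + 1) \<subseteq> B - f ` range (\<lambda>n. 2 * n)"
    using f(2) by fastforce
  ultimately show thesis
    using that infinite_super by metis
qed

lemma splitting_number: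
  shows "\<exists>\<S>. splitting_family \<S> \<and> |\<S>| =o \<ss>"
    and "splitting_family \<S> \<Longrightarrow> \<ss> \<le>o |\<S>|"
proof -
  have "\<exists>C\<in>infinite_subsets. \<not> B \<subseteq>* C \<and> \<not> B \<subseteq>* UNIV - C" if "B \<in> infinite_subsets" for B
  proof -
    from that obtain C where C: "infinite (B \<inter> C)" "infinite (B - C)"
      using infinite_split[of B] by (auto simp: infinite_subsets_def)
    moreover have "B - (UNIV - C) = B \<inter> C"
      by blast
    ultimately show ?thesis
      by (intro bexI[of _ C]) (auto simp: infinite_subsets_def almost_subset_def)
  qed
  then have "splitting_family infinite_subsets"
    unfolding splitting_family_def by blast
  then have *: "\<exists>\<S>. splitting_family \<S> \<and> |\<S>| =o |infinite_subsets|"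
    using card_of_refl by blast
  note l = least_cardinal[where P = "\<lambda>\<kappa>. \<exists>\<S>. splitting_family \<S> \<and> |\<S>| =o \<kappa>",
      OF card_of_Card_order *, folded splitting_number_def]
  show "\<exists>\<S>. splitting_family \<S> \<and> |\<S>| =o \<ss>"
    by (rule l(2))
  show "splitting_family \<S> \<Longrightarrow> \<ss> \<le>o |\<S>|"
    by (rule l(3)[OF card_of_Card_order]) (use card_of_refl in blast)
qed

lemma a_star_sequence_exists: "\<exists>(\<kappa> :: nat set rel) A. Card_order \<kappa> \<and> a_star_sequence \<kappa> A"
proof -
  define C :: "nat \<Rightarrow> nat set" where "C n = range (\<lambda>k. prod_encode (n, k))" for n
  have C_inf: "infinite (C n)" for n
    unfolding C_def using infinite_UNIV_nat
    by (subst finite_image_iff) (auto simp: inj_on_def prod_encode_eq)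
  have C_disj: "C m \<inter> C n = {}" if "m \<noteq> n" for m n
    using that unfolding C_def by (auto simp: prod_encode_eq)
  define \<F> where "\<F> = {M. range C \<subseteq> M \<and> M \<subseteq> infinite_subsets \<and> pairwise almost_disjoint M}"
  have "almost_disjoint (C m) (C n)" if "C m \<noteq> C n" for m n
    using C_disj[of m n] that unfolding almost_disjoint_def by (metis finite.emptyI)
  then have "range C \<in> \<F>"
    using C_inf by (auto simp: \<F>_def infinite_subsets_def pairwise_def)
  moreover have "\<Union>\<C> \<in> \<F>" if "\<C> \<noteq> {}" "subset.chain \<F> \<C>" for \<C>
  proof -
    have \<C>: "\<C> \<subseteq> \<F>" and lin: "\<And>X Y. X \<in> \<C> \<Longrightarrow> Y \<in> \<C> \<Longrightarrow> X \<subseteq> Y \<or> Y \<subseteq> X"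
      using that(2) by (auto simp: subset_chain_def)
    have "pairwise almost_disjoint (\<Union>\<C>)"
      unfolding pairwise_def
    proof (intro ballI impI)
      fix x y assume "x \<in> \<Union>\<C>" "y \<in> \<Union>\<C>" "x \<noteq> y"
      then obtain X where "X \<in> \<C>" "x \<in> X" "y \<in> X"
        using lin by blast
      then show "almost_disjoint x y"
        using \<C> \<open>x \<noteq> y\<close> unfolding \<F>_def pairwise_def by blast
    qed
    then show ?thesis
      using \<C> that(1) unfolding \<F>_def by blast
  qed
  ultimately obtain M where M: "M \<in> \<F>" and max: "\<And>X. X \<in> \<F> \<Longrightarrow> M \<subseteq> X \<Longrightarrow> X = M"
    using subset_Zorn_nonempty[of \<F>] by blast
  define A :: "nat set + nat \<Rightarrow> nat set" where "A = case_sum (\<lambda>X. X) C"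
  have "a_star_sequence |M - range C| A"
    unfolding a_star_sequence_def Field_card_of
  proof (intro conjI notI)
    show "\<forall>i \<in> (M - range C) <+> UNIV. A i \<in> infinite_subsets"
      using M C_inf by (auto simp: A_def \<F>_def infinite_subsets_def)
    have M_ad: "almost_disjoint X Y" if "X \<in> M" "Y \<in> M" "X \<noteq> Y" for X Y
      using M that unfolding \<F>_def pairwise_def by blast
    have C_M: "C n \<in> M" for n
      using M unfolding \<F>_def by blast
    have C_eq: "C m = C n \<longleftrightarrow> m = n" for m n
      using C_disj[of m n] C_inf[of n] by (cases "m = n") auto
    show "pairwise (\<lambda>i j. almost_disjoint (A i) (A j)) ((M - range C) <+> UNIV)"
      unfolding pairwise_def
    proof (intro ballI impI)
      fix i j :: "nat set + nat"
      assume "i \<in> (M - range C) <+> UNIV" "j \<in> (M - range C) <+> UNIV" "i \<noteq> j"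
      then have "A i \<in> M" "A j \<in> M" "A i \<noteq> A j"
        by (auto simp: A_def C_M C_eq)
      then show "almost_disjoint (A i) (A j)"
        by (rule M_ad)
    qed
  next
    assume "\<exists>B\<in>infinite_subsets. (\<forall>\<alpha>\<in>M - range C. almost_disjoint B (A (Inl \<alpha>))) \<and>
      infinite {n. infinite (B \<inter> A (Inr n))}"
    then obtain B where B: "\<And>X. X \<in> M - range C \<Longrightarrow> finite (B \<inter> X)"
      and inf: "infinite {n. infinite (B \<inter> C n)}" (is "infinite ?N")
      by (auto simp: A_def almost_disjoint_def)
    have "\<forall>n\<in>?N. \<exists>b. b \<in> B \<inter> C n"
    proof
      fix n assume "n \<in> ?N"
      then have "B \<inter> C n \<noteq> {}"
        by auto
      then show "\<exists>b. b \<in> B \<inter> C n"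
        by blast
    qed
    then obtain b where b: "\<And>n. n \<in> ?N \<Longrightarrow> b n \<in> B \<inter> C n"
      by metis
    have b_C: "m = n" if "m \<in> ?N" "b m \<in> C n" for m n
      using b[OF that(1)] that(2) C_disj[of m n] by blast
    have "inj_on b ?N"
    proof (rule inj_onI)
      fix m n assume "m \<in> ?N" "n \<in> ?N" "b m = b n"
      then show "m = n"
        using b_C[of m n] b[of n] by simp
    qed
    then have B'_inf: "infinite (b ` ?N)"
      using inf by (simp add: finite_image_iff)
    have "b ` ?N \<inter> C n \<subseteq> {b n}" for n
      using b_C by blast
    then have B'_C: "finite (b ` ?N \<inter> C n)" for n
      by (rule finite_subset) simp
    have "b ` ?N \<subseteq> B"
      using b by blast
    then have B'_M: "finite (b ` ?N \<inter> X)" if "X \<in> M - range C" for X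
      by (intro finite_subset[OF _ B[OF that]]) blast
    have fin: "finite (b ` ?N \<inter> X)" if "X \<in> M" for X
      using that B'_C B'_M by blast
    have "insert (b ` ?N) M \<in> \<F>"
      using M B'_inf fin
      by (simp add: \<F>_def infinite_subsets_def pairwise_insert almost_disjoint_def Int_commute
          subset_insertI2)
    then have "b ` ?N \<in> M"
      using max by blast
    then show False
      using fin[of "b ` ?N"] B'_inf by simp
  qed
  then show ?thesis
    using card_of_Card_order by blast
qed

lemma a_star:
  shows "Card_order \<aa>\<^sub>*" and "\<exists>A. a_star_sequence \<aa>\<^sub>* A"
  using a_star_sequence_exists least_cardinal(1,2)[of _ "\<lambda>\<kappa>. \<exists>A. a_star_sequence \<kappa> A"]
  unfolding a_star_def by blast+

lemma a_star_le:
  fixes \<kappa> :: "'i rel"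
  assumes \<kappa>: "Card_order \<kappa>" and A: "a_star_sequence \<kappa> A"
  shows "\<aa>\<^sub>* \<le>o \<kappa>"
proof -
  define X where "X = (\<lambda>\<alpha>. A (Inl \<alpha>)) ` Field \<kappa>"
  define A' where "A' = case_sum (\<lambda>x. x) (\<lambda>n. A (Inr n))"
  have "a_star_sequence |X| A'"
    unfolding a_star_sequence_def Field_card_of
  proof (intro conjI)
    have inf: "A i \<in> infinite_subsets" if "i \<in> Field \<kappa> <+> UNIV" for i
      using A that by (auto simp: a_star_sequence_def)
    have ad: "almost_disjoint (A i) (A j)"
      if "i \<in> Field \<kappa> <+> UNIV" "j \<in> Field \<kappa> <+> UNIV" "i \<noteq> j" for i j
      using A that unfolding a_star_sequence_def pairwise_def by blast
    show "\<forall>i \<in> X <+> UNIV. A' i \<in> infinite_subsets"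
      by (auto simp: A'_def X_def intro!: inf)
    show "pairwise (\<lambda>i j. almost_disjoint (A' i) (A' j)) (X <+> UNIV)"
      unfolding pairwise_def
    proof (intro ballI impI)
      fix i j :: "nat set + nat" assume "i \<in> X <+> UNIV" "j \<in> X <+> UNIV" "i \<noteq> j"
      moreover have "\<exists>i'\<in>Field \<kappa> <+> UNIV. A' i = A i' \<and> (\<forall>n. i = Inr n \<longleftrightarrow> i' = Inr n)"
        if "i \<in> X <+> UNIV" for i
        using that by (cases i) (auto simp: X_def A'_def intro: bexI[OF _ InlI] bexI[OF _ InrI])
      ultimately obtain i' j' where
        i': "i' \<in> Field \<kappa> <+> UNIV" "A' i = A i'" "\<forall>n. i = Inr n \<longleftrightarrow> i' = Inr n" and
        j': "j' \<in> Field \<kappa> <+> UNIV" "A' j = A j'" "\<forall>n. j = Inr n \<longleftrightarrow> j' = Inr n"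
        by meson
      have "i' \<noteq> j'"
      proof
        assume eq: "i' = j'"
        show False
        proof (cases i)
          case (Inl x)
          then obtain y where "j = Inl y"
            using i'(3) j'(3) eq by (cases j) auto
          then show False
            using Inl i'(2) j'(2) eq \<open>i \<noteq> j\<close> by (simp add: A'_def)
        next
          case (Inr n)
          then show False
            using i'(3) j'(3) eq \<open>i \<noteq> j\<close> by auto
        qed
      qed
      then show "almost_disjoint (A' i) (A' j)"
        using ad[of i' j'] i'(1,2) j'(1,2) by simp
    qed
    show "\<not> (\<exists>B\<in>infinite_subsets. (\<forall>\<alpha>\<in>X. almost_disjoint B (A' (Inl \<alpha>))) \<and>
        infinite {n. infinite (B \<inter> A' (Inr n))})"
      using A by (auto simp: A'_def X_def a_star_sequence_def)
  qed
  then have "\<aa>\<^sub>* \<le>o |X|"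
    using least_cardinal(3)[of "|X|" "\<lambda>\<kappa>. \<exists>A. a_star_sequence \<kappa> A"] card_of_Card_order
    unfolding a_star_def by blast
  also have "|X| \<le>o |Field \<kappa>|"
    unfolding X_def by (rule card_of_image)
  also have "|Field \<kappa>| =o \<kappa>"
    by (rule card_of_Field_ordIso[OF \<kappa>])
  finally show ?thesis .
qed

end

theory Submission
  imports Defs "HOL-Library.Infinite_Set"
begin

text \<open>
  Fix a splitting family \<open>S\<close> of size \<open>\<ss>\<close> and a well-order of it. The saturated family is built by
  transfinite recursion along all sets \<open>B \<subseteq> \<omega>\<close>: if \<open>B\<close> lies outside the ideal of the family
  \<open>\<A>\<close> built so far (call such sets positive), a new member \<open>a \<subseteq> B\<close>, almost disjoint from all of
  \<open>\<A>\<close>, is added. The final family then contains a subset of each of its positive sets, which for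
  an AD family is all that is needed (\<open>saturated_MADI\<close>). The difficulty is that too many members of
  \<open>\<A>\<close> may meet \<open>B\<close> (here and below: in an infinite set), whereas \<open>\<ss> < \<aa>\<^sub>*\<close>
  only helps against \<open>\<ss>\<close> many: by \<open>positive_escapes_small\<close>, a positive set has an infinite subset almost disjoint from any prescribed \<open>\<ss>\<close> many members.

  A first consequence is \<open>positive_split\<close>: every positive set \<open>b\<close> is cut into two positive pieces by
  some element of \<open>S\<close>. Let \<open>e(b)\<close> be the first such element. Each earlier \<open>e\<close> leaves exactly one side
  of \<open>b\<close> positive, so \<open>b\<close> determines a \<open>0\<close>-\<open>1\<close>-sequence indexed by the elements of \<open>S\<close> below \<open>e(b)\<close>,
  its type. With \<open>\<A> = {}\<close>, so that positive means infinite, this also gives a type to every infinite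
  set. The recursion keeps the types of the members of \<open>\<A>\<close> pairwise distinct.

  Given a positive \<open>B\<close>, cutting repeatedly by \<open>e(b)\<close> yields a binary tree of positive sets. Every
  branch of it has a positive pseudo-intersection (\<open>positive_pseudo_intersection\<close>), and the types of
  those for different branches are incompatible, so a member of \<open>\<A>\<close> extends the type of at most one
  of them. As \<open>\<A>\<close> has fewer than continuum many members, there is a positive \<open>P \<subseteq> B\<close> whose type no
  member extends (\<open>unfollowed_positive\<close>). A member \<open>a\<close> of \<open>\<A>\<close> that meets \<open>P\<close> in an infinite set then
  either leaves the type of \<open>P\<close> at some \<open>e\<close>, or has a proper initial part of it as its own type. The
  first case concerns finitely many \<open>a\<close> for each \<open>e\<close>, because the side of \<open>P\<close> chosen by \<open>a\<close> is in the
  ideal; the second one at most one \<open>a\<close> for each \<open>e\<close>, because types are distinct. So at most \<open>\<ss>\<close>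
  members meet \<open>P\<close> (\<open>unfollowed_meets_few\<close>), and there is an infinite \<open>a \<subseteq> P\<close> almost disjoint from
  all of \<open>\<A>\<close>. Its type extends that of \<open>P\<close>, hence is new, and the recursion continues.
\<close>

section \<open>The ideal generated by a family\<close>

lemma id_ideal_iff: "X \<in> id_ideal \<A> \<longleftrightarrow> (\<exists>\<F>. finite \<F> \<and> \<F> \<subseteq> \<A> \<and> finite (X - \<Union>\<F>))"
proof
  let ?I = "{X. \<exists>\<F>. finite \<F> \<and> \<F> \<subseteq> \<A> \<and> finite (X - \<Union>\<F>)}"
  have "set_ideal ?I"
    unfolding set_ideal_def
  proof (intro conjI ballI allI impI)
    show "{} \<in> ?I" by (intro CollectI exI[of _ "{}"]) simp
    fix X Y assume "X \<in> ?I"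
    then obtain F where F: "finite F" "F \<subseteq> \<A>" "finite (X - \<Union>F)" by blast
    { assume "Y \<in> ?I"
      then obtain G where G: "finite G" "G \<subseteq> \<A>" "finite (Y - \<Union>G)" by blast
      have "X \<union> Y - \<Union>(F \<union> G) \<subseteq> (X - \<Union>F) \<union> (Y - \<Union>G)" by blast
      then have "finite (X \<union> Y - \<Union>(F \<union> G))"
        using F(3) G(3) by (metis finite_Un finite_subset)
      then show "X \<union> Y \<in> ?I" using F G by (intro CollectI exI[of _ "F \<union> G"]) auto }
    { assume "Y \<subseteq> X"
      then have "finite (Y - \<Union>F)" using F(3) by (meson Diff_mono finite_subset order_refl)
      then show "Y \<in> ?I" using F by blast }
  qed
  moreover have "\<A> \<union> {F. finite F} \<subseteq> ?I"
  proof
    fix X assume "X \<in> \<A> \<union> {F. finite F}"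
    then show "X \<in> ?I"
    proof
      assume "X \<in> \<A>" then show ?thesis by (intro CollectI exI[of _ "{X}"]) simp
    next
      assume "X \<in> {F. finite F}" then show ?thesis by (intro CollectI exI[of _ "{}"]) simp
    qed
  qed
  ultimately have "id_ideal \<A> \<subseteq> ?I"
    unfolding id_ideal_def by (intro hull_minimal) auto
  then show "X \<in> id_ideal \<A> \<Longrightarrow> \<exists>\<F>. finite \<F> \<and> \<F> \<subseteq> \<A> \<and> finite (X - \<Union>\<F>)" by blast
next
  assume "\<exists>\<F>. finite \<F> \<and> \<F> \<subseteq> \<A> \<and> finite (X - \<Union>\<F>)"
  then obtain F where F: "finite F" "F \<subseteq> \<A>" "finite (X - \<Union>F)" by blast
  show "X \<in> id_ideal \<A>"
    unfolding id_ideal_def hull_def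
  proof (intro InterI, clarify)
    fix I assume I: "set_ideal I" "\<A> \<union> {F. finite F} \<subseteq> I"
    have "\<Union>F \<in> I" using F(1,2)
      by (induction F) (use I in \<open>auto simp: set_ideal_def\<close>)
    moreover have "X - \<Union>F \<in> I" using I(2) F(3) by auto
    ultimately have "\<Union>F \<union> (X - \<Union>F) \<in> I" using I(1) unfolding set_ideal_def by blast
    moreover have "X \<subseteq> \<Union>F \<union> (X - \<Union>F)" by blast
    ultimately show "X \<in> I" using I(1) by (meson set_ideal_def)
  qed
qed

lemma id_ideal_empty: "X \<in> id_ideal {} \<longleftrightarrow> finite X"
  by (simp add: id_ideal_iff)

lemma finite_in_id_ideal: "finite X \<Longrightarrow> X \<in> id_ideal \<A>"
  unfolding id_ideal_iff by (intro exI[of _ "{}"]) simp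

lemma id_ideal_almost_subset:
  assumes "Y \<in> id_ideal \<A>" "finite (X - Y)"
  shows "X \<in> id_ideal \<A>"
proof -
  obtain F where F: "finite F" "F \<subseteq> \<A>" "finite (Y - \<Union>F)"
    using assms(1) unfolding id_ideal_iff by blast
  have "X - \<Union>F \<subseteq> (X - Y) \<union> (Y - \<Union>F)" by blast
  then have "finite (X - \<Union>F)" using F(3) assms(2) by (metis finite_Un finite_subset)
  then show ?thesis using F unfolding id_ideal_iff by blast
qed

lemma id_ideal_Un:
  assumes "X \<in> id_ideal \<A>" "Y \<in> id_ideal \<A>"
  shows "X \<union> Y \<in> id_ideal \<A>"
proof -
  obtain F where F: "finite F" "F \<subseteq> \<A>" "finite (X - \<Union>F)"
    using assms(1) unfolding id_ideal_iff by blast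
  obtain G where G: "finite G" "G \<subseteq> \<A>" "finite (Y - \<Union>G)"
    using assms(2) unfolding id_ideal_iff by blast
  have "X \<union> Y - \<Union>(F \<union> G) \<subseteq> (X - \<Union>F) \<union> (Y - \<Union>G)" by blast
  then have "finite (X \<union> Y - \<Union>(F \<union> G))"
    using F(3) G(3) by (metis finite_Un finite_subset)
  then show ?thesis
    unfolding id_ideal_iff using F G by (intro exI[of _ "F \<union> G"]) auto
qed

lemma id_ideal_mono: "\<A> \<subseteq> \<B> \<Longrightarrow> id_ideal \<A> \<subseteq> id_ideal \<B>"
  unfolding id_ideal_iff subset_iff by meson

lemma id_ideal_almost_disjoint_finite:
  assumes "X \<in> id_ideal \<A>" "Y \<subseteq> X" "\<And>A. A \<in> \<A> \<Longrightarrow> finite (Y \<inter> A)"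
  shows "finite Y"
proof -
  obtain F where F: "finite F" "F \<subseteq> \<A>" "finite (X - \<Union>F)"
    using assms(1) unfolding id_ideal_iff by blast
  have "Y \<subseteq> (\<Union>A\<in>F. Y \<inter> A) \<union> (X - \<Union>F)" using assms(2) by blast
  moreover have "finite (Y \<inter> A)" if "A \<in> F" for A using F(2) assms(3) that by blast
  then have "finite ((\<Union>A\<in>F. Y \<inter> A) \<union> (X - \<Union>F))" using F by blast
  ultimately show ?thesis by (rule finite_subset)
qed

text \<open>
  A member outside the finite subfamily that covers \<open>X\<close> meets each set of that subfamily, hence also
  \<open>X\<close>, in a finite set.
\<close>
lemma id_ideal_finite_meets:
  assumes "pairwise almost_disjoint \<A>" "X \<in> id_ideal \<A>"
  shows "finite {A \<in> \<A>. infinite (A \<inter> X)}"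
proof -
  obtain F where F: "finite F" "F \<subseteq> \<A>" "finite (X - \<Union>F)"
    using assms(2) unfolding id_ideal_iff by blast
  have "A \<in> F" if A: "A \<in> \<A>" "infinite (A \<inter> X)" for A
  proof (rule ccontr)
    assume "A \<notin> F"
    then have "finite (A \<inter> B)" if "B \<in> F" for B
      using pairwiseD[OF assms(1) A(1), of B] F(2) that \<open>A \<notin> F\<close>
      by (auto simp: almost_disjoint_def)
    then have "finite ((\<Union>B\<in>F. A \<inter> B) \<union> (X - \<Union>F))" using F by blast
    moreover have "A \<inter> X \<subseteq> (\<Union>B\<in>F. A \<inter> B) \<union> (X - \<Union>F)" by blast
    ultimately show False using A(2) finite_subset by blast
  qed
  then show ?thesis using F(1) by (metis (no_types, lifting) finite_subset mem_Collect_eq subsetI)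
qed

lemma positive_minus_finite:
  assumes "X \<notin> id_ideal \<A>" "finite \<F>" "\<F> \<subseteq> \<A>"
  shows "X - \<Union>\<F> \<notin> id_ideal \<A>"
proof
  assume "X - \<Union>\<F> \<in> id_ideal \<A>"
  moreover have "\<Union>\<F> \<in> id_ideal \<A>"
    unfolding id_ideal_iff using assms(2,3) by (intro exI[of _ \<F>]) simp
  ultimately have "(X - \<Union>\<F>) \<union> \<Union>\<F> \<in> id_ideal \<A>" by (rule id_ideal_Un)
  moreover have "X - ((X - \<Union>\<F>) \<union> \<Union>\<F>) = {}" by blast
  ultimately have "X \<in> id_ideal \<A>" using id_ideal_almost_subset by (metis finite.emptyI)
  then show False using assms(1) by blast
qed

section \<open>Positive pseudo-intersections\<close>
lemma pseudo_intersection: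
  fixes D :: "nat \<Rightarrow> nat set"
  assumes "decseq D" "\<And>n. infinite (D n)"
  obtains P where "infinite P" "P \<subseteq> D 0" "\<And>n. finite (P - D n)"
proof -
  have "\<exists>x. x \<in> D n \<and> n \<le> x" for n
    using assms(2)[of n] by (meson finite_nat_set_iff_bounded_le nat_le_linear)
  then obtain x where x: "\<And>n. x n \<in> D n" "\<And>n. n \<le> x n" by metis
  show thesis
  proof
    show "infinite (range x)"
      using x(2) unfolding infinite_nat_iff_unbounded_le by blast
    show "range x \<subseteq> D 0" using x(1) assms(1) by (auto simp: decseq_def)
    show "finite (range x - D n)" for n
    proof (rule finite_subset)
      show "range x - D n \<subseteq> x ` {..<n}"
      proof
        fix y assume y: "y \<in> range x - D n"
        then obtain m where m: "y = x m" by blast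
        then have "\<not> n \<le> m" using y x(1)[of m] decseqD[OF assms(1), of n m] by blast
        then show "y \<in> x ` {..<n}" using m by simp
      qed
    qed simp
  qed
qed

text \<open>
  The branches of the tree need pseudo-intersections that are still positive. Let \<open>H\<close> be the set of
  members that meet all \<open>D n\<close> in infinite sets. If \<open>H\<close> is finite, discarding \<open>\<Union>H\<close> leaves sets whose
  pseudo-intersections are almost disjoint from every member. If \<open>H\<close> is infinite, glueing
  pseudo-intersections inside countably many elements of \<open>H\<close> gives a set that meets infinitely many
  members in infinite sets.
\<close>
lemma positive_pseudo_intersection:
  fixes D :: "nat \<Rightarrow> nat set"
  assumes ad: "pairwise almost_disjoint \<A>"
    and D: "decseq D" "\<And>n. D n \<notin> id_ideal \<A>"
  obtains P where "P \<notin> id_ideal \<A>" "P \<subseteq> D 0" "\<And>n. finite (P - D n)"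
proof -
  define H where "H = {A \<in> \<A>. \<forall>n. infinite (A \<inter> D n)}"
  show thesis
  proof (cases "finite H")
    case True
    have "infinite (D n - \<Union>H)" for n
      using positive_minus_finite[OF D(2) True] finite_in_id_ideal by (auto simp: H_def)
    moreover have "decseq (\<lambda>n. D n - \<Union>H)" using D(1) by (auto simp: decseq_def)
    ultimately obtain P where P: "infinite P" "P \<subseteq> D 0 - \<Union>H" "\<And>n. finite (P - (D n - \<Union>H))"
      using pseudo_intersection[of "\<lambda>n. D n - \<Union>H"] by blast
    have PD: "finite (P - D n)" for n
      using P(3)[of n] by (rule finite_subset[rotated]) blast
    have "finite (P \<inter> A)" if "A \<in> \<A>" for A
    proof (cases "A \<in> H")
      case True
      then have "P \<inter> A = {}" using P(2) by blast
      then show ?thesis by simp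
    next
      case False
      then obtain n where "finite (A \<inter> D n)" using \<open>A \<in> \<A>\<close> by (auto simp: H_def)
      then have "finite ((A \<inter> D n) \<union> (P - D n))" using PD by simp
      then show ?thesis by (rule finite_subset[rotated]) blast
    qed
    then have "P \<notin> id_ideal \<A>" using P(1) id_ideal_almost_disjoint_finite[of P \<A> P] by blast
    then show ?thesis using that P(2) PD by blast
  next
    case False
    then obtain c :: "nat \<Rightarrow> nat set" where c: "inj c" "range c \<subseteq> H"
      using infinite_countable_subset by blast
    have "\<exists>p. infinite p \<and> p \<subseteq> c n \<inter> D n \<and> (\<forall>m. finite (p - D m))" for n
    proof -
      have "decseq (\<lambda>m. c n \<inter> D (n + m))"
        using D(1) unfolding decseq_def by (meson Int_mono add_left_mono order_refl)
      moreover have "infinite (c n \<inter> D (n + m))" for m using c(2) by (auto simp: H_def)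
      ultimately obtain p where p: "infinite p" "p \<subseteq> c n \<inter> D n"
        "\<And>m. finite (p - (c n \<inter> D (n + m)))"
        using pseudo_intersection[of "\<lambda>m. c n \<inter> D (n + m)"] by auto
      have "p - D m \<subseteq> p - (c n \<inter> D (n + m))" for m
        using decseqD[OF D(1) le_add2[of m n]] by blast
      then have "finite (p - D m)" for m using p(3) finite_subset by blast
      then show ?thesis using p by blast
    qed
    then obtain p where p: "\<And>n. infinite (p n)" "\<And>n. p n \<subseteq> c n \<inter> D n" "\<And>n m. finite (p n - D m)"
      by metis
    define P where "P = (\<Union>n. p n)"
    have "infinite (c n \<inter> P)" for n
      using p(1)[of n] by (rule infinite_super[rotated]) (use p(2)[of n] in \<open>auto simp: P_def\<close>)
    then have "range c \<subseteq> {A \<in> \<A>. infinite (A \<inter> P)}" using c(2) by (auto simp: H_def)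
    then have "P \<notin> id_ideal \<A>"
      using id_ideal_finite_meets[OF ad] range_inj_infinite[OF c(1)] finite_subset by blast
    moreover have "P \<subseteq> D 0"
      unfolding P_def using p(2) decseqD[OF D(1), of 0] by blast
    moreover have "finite (P - D m)" for m
    proof (rule finite_subset)
      show "P - D m \<subseteq> (\<Union>n<m. p n - D m)"
      proof
        fix y assume y: "y \<in> P - D m"
        then obtain n where n: "y \<in> p n" by (auto simp: P_def)
        then have "\<not> m \<le> n" using y p(2)[of n] decseqD[OF D(1), of m n] by blast
        then show "y \<in> (\<Union>n<m. p n - D m)" using n y by auto
      qed
      show "finite (\<Union>n<m. p n - D m)" using p(3) by blast
    qed
    ultimately show ?thesis using that by blast
  qed
qed

section \<open>Positive sets against fewer than \<open>\<aa>\<^sub>*\<close> members\<close>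

text \<open>
  If infinitely many elements of \<open>X\<close> meet \<open>b\<close>, countably many of them serve as the last \<open>\<omega>\<close> entries
  \<open>c n\<close> of a sequence, the others as its beginning. As the beginning is shorter than \<open>\<aa>\<^sub>*\<close>, some
  infinite set avoids it and still meets infinitely many \<open>c n\<close>; hence one can diagonalise out of all
  \<open>c n\<close> as well. The bound on \<open>X\<close> is stated through finite sets indexed by \<open>S\<close> because in both
  applications every element of \<open>S\<close> accounts for finitely many elements of \<open>X\<close>.
\<close>
lemma positive_escapes_small:
  fixes S :: "'e set"
  assumes ad: "pairwise almost_disjoint \<A>" and b: "b \<notin> id_ideal \<A>"
    and S: "|S| <o \<aa>\<^sub>*"
    and X: "X \<subseteq> \<A>" "X \<subseteq> (\<Union>e\<in>S. F e)" "\<And>e. e \<in> S \<Longrightarrow> finite (F e)"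
  obtains B where "infinite B" "B \<subseteq> b" "\<And>A. A \<in> X \<Longrightarrow> finite (B \<inter> A)"
proof -
  define Y where "Y = {A \<in> X. infinite (b \<inter> A)}"
  have YX: "Y \<subseteq> X" by (auto simp: Y_def)
  show thesis
  proof (cases "finite Y")
    case True
    have "b - \<Union>Y \<notin> id_ideal \<A>"
      using positive_minus_finite[OF b True] X(1) by (auto simp: Y_def)
    then have "infinite (b - \<Union>Y)" using finite_in_id_ideal by blast
    moreover have "finite ((b - \<Union>Y) \<inter> A)" if "A \<in> X" for A
    proof (cases "A \<in> Y")
      case True
      then have "(b - \<Union>Y) \<inter> A = {}" by blast
      then show ?thesis by simp
    next
      case False
      then have "finite (b \<inter> A)" using that by (auto simp: Y_def)
      then show ?thesis by (rule finite_subset[rotated]) blast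
    qed
    ultimately show ?thesis using that by blast
  next
    case False
    then obtain c :: "nat \<Rightarrow> nat set" where c: "inj c" "range c \<subseteq> Y"
      using infinite_countable_subset by blast
    have "infinite S"
      using False YX X(2,3) by (meson finite_UN finite_subset)
    have "|F e| \<le>o |S|" if "e \<in> S" for e
      using finite_ordLess_infinite[OF card_of_Well_order card_of_Well_order, of "F e" S]
        X(3)[OF that] \<open>infinite S\<close> by (simp add: Field_card_of ordLess_imp_ordLeq)
    then have "|\<Union>e\<in>S. F e| \<le>o |S|"
      using card_of_UNION_ordLeq_infinite[OF \<open>infinite S\<close> ordIso_imp_ordLeq[OF card_of_refl]] by blast
    moreover have "|Y - range c| \<le>o |\<Union>e\<in>S. F e|"
      using YX X(2) by (intro card_of_mono1) blast
    ultimately have small: "|Y - range c| <o \<aa>\<^sub>*"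
      using S ordLeq_ordLess_trans ordLeq_transitive by blast
    define s where "s = case_sum (\<lambda>A. b \<inter> A) (\<lambda>n. b \<inter> c n)"
    have adY: "finite (A \<inter> A')" if "A \<in> Y" "A' \<in> Y" "A \<noteq> A'" for A A'
      using pairwiseD[OF ad, of A A'] X(1) YX that by (auto simp: almost_disjoint_def)
    have "\<not> a_star_sequence |Y - range c| s"
      using small a_star_le[OF card_of_Card_order] not_ordLess_ordLeq by blast
    moreover have "s i \<in> infinite_subsets" if "i \<in> (Y - range c) <+> UNIV" for i
      using that c(2) by (auto simp: s_def infinite_subsets_def Y_def)
    moreover have "pairwise (\<lambda>i j. almost_disjoint (s i) (s j)) ((Y - range c) <+> UNIV)"
      unfolding pairwise_def
    proof (intro ballI impI)
      fix i j :: "nat set + nat"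
      assume ij: "i \<in> (Y - range c) <+> UNIV" "j \<in> (Y - range c) <+> UNIV" "i \<noteq> j"
      define t where "t = case_sum (\<lambda>A. A) c"
      have "t i \<in> Y" "t j \<in> Y" "t i \<noteq> t j"
        using ij c by (auto simp: t_def inj_eq)
      then have "finite (t i \<inter> t j)" by (rule adY)
      moreover have "s i \<inter> s j \<subseteq> t i \<inter> t j"
        by (auto simp: s_def t_def split: sum.splits)
      ultimately show "almost_disjoint (s i) (s j)"
        unfolding almost_disjoint_def by (rule finite_subset[rotated])
    qed
    ultimately obtain B0 where B0: "\<And>A. A \<in> Y - range c \<Longrightarrow> finite (B0 \<inter> (b \<inter> A))"
      "infinite {n. infinite (B0 \<inter> (b \<inter> c n))}"
      unfolding a_star_sequence_def Field_card_of by (auto simp: s_def almost_disjoint_def)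
    \<comment> \<open>The sets \<open>D k\<close> stay infinite because \<open>B0 \<inter> b\<close> meets infinitely many \<open>c n\<close>.\<close>
    define D where "D k = B0 \<inter> b - (\<Union>j<k. c j)" for k
    have "infinite (D k)" for k
    proof -
      obtain n where n: "n \<ge> k" "infinite (B0 \<inter> (b \<inter> c n))"
        using B0(2)[unfolded infinite_nat_iff_unbounded_le[of "{n. _ n}"]] by blast
      have "finite (c n \<inter> c j)" if "j < k" for j
        using that n(1) c by (intro adY) (auto simp: inj_eq)
      then have "finite (\<Union>j<k. c n \<inter> c j)" by blast
      then have "infinite (B0 \<inter> (b \<inter> c n) - (\<Union>j<k. c n \<inter> c j))" using n(2) by simp
      then show ?thesis by (rule infinite_super[rotated]) (auto simp: D_def)
    qed
    moreover have "decseq D" by (force simp: D_def decseq_def)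
    ultimately obtain B where B: "infinite B" "B \<subseteq> D 0" "\<And>n. finite (B - D n)"
      using pseudo_intersection by blast
    have Bb: "B \<subseteq> B0 \<inter> b" using B(2) by (simp add: D_def)
    have "finite (B \<inter> A)" if "A \<in> X" for A
    proof (cases "A \<in> Y")
      case False
      then have "finite (b \<inter> A)" using that by (auto simp: Y_def)
      then show ?thesis by (rule finite_subset[rotated]) (use Bb in blast)
    next
      case True
      show ?thesis
      proof (cases "A \<in> range c")
        case True
        then obtain n where "A = c n" by blast
        then have "B \<inter> A \<subseteq> B - D (Suc n)" by (auto simp: D_def)
        then show ?thesis using B(3) finite_subset by blast
      next
        case False
        then have "finite (B0 \<inter> (b \<inter> A))" using True B0(1) by blast
        then show ?thesis by (rule finite_subset[rotated]) (use Bb in blast)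
      qed
    qed
    then show ?thesis using that B(1) Bb by blast
  qed
qed

definition splits :: "nat set set \<Rightarrow> nat set \<Rightarrow> nat set \<Rightarrow> bool"
  where "splits \<A> e b \<longleftrightarrow> b \<inter> e \<notin> id_ideal \<A> \<and> b - e \<notin> id_ideal \<A>"

lemma splits_almost_subset:
  assumes "splits \<A> e b" "finite (b - c)"
  shows "splits \<A> e c"
proof -
  have "finite (b \<inter> e - c \<inter> e)" "finite (b - e - (c - e))"
    using assms(2) by (auto elim: finite_subset[rotated])
  then show ?thesis using assms(1) id_ideal_almost_subset unfolding splits_def by blast
qed

text \<open>
  Otherwise every \<open>e \<in> S\<close> leaves a side \<open>h e\<close> of \<open>b\<close> in the ideal, and finitely many members meet
  \<open>h e\<close>. Altogether these are few, so \<open>b\<close> has an infinite subset almost disjoint from all of them. It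
  meets each \<open>h e\<close> in a finite set, so no element of \<open>S\<close> splits it.
\<close>
lemma positive_split:
  assumes ad: "pairwise almost_disjoint \<A>" and b: "b \<notin> id_ideal \<A>"
    and S: "splitting_family S" "|S| <o \<aa>\<^sub>*"
  obtains e where "e \<in> S" "splits \<A> e b"
proof (rule ccontr)
  assume "\<not> thesis"
  then have no: "b \<inter> e \<in> id_ideal \<A> \<or> b - e \<in> id_ideal \<A>" if "e \<in> S" for e
    using that \<open>\<And>e. \<lbrakk>e \<in> S; splits \<A> e b\<rbrakk> \<Longrightarrow> thesis\<close> by (auto simp: splits_def)
  define h where "h e = (if b \<inter> e \<in> id_ideal \<A> then b \<inter> e else b - e)" for e
  have h: "h e \<in> id_ideal \<A>" if "e \<in> S" for e
    using no[OF that] by (auto simp: h_def)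
  define F where "F e = {A \<in> \<A>. infinite (A \<inter> h e)}" for e
  obtain B where B: "infinite B" "B \<subseteq> b" "\<And>A. A \<in> (\<Union>e\<in>S. F e) \<Longrightarrow> finite (B \<inter> A)"
    using positive_escapes_small[OF ad b S(2), of "\<Union>e\<in>S. F e" F]
      id_ideal_finite_meets[OF ad h] by (auto simp: F_def)
  have "finite (B \<inter> h e)" if e: "e \<in> S" for e
  proof (rule id_ideal_almost_disjoint_finite[OF h[OF e]])
    fix A assume "A \<in> \<A>"
    show "finite (B \<inter> h e \<inter> A)"
    proof (cases "A \<in> F e")
      case True
      then have "finite (B \<inter> A)" using B(3) e by blast
      then show ?thesis by (rule finite_subset[rotated]) blast
    next
      case False
      then have "finite (A \<inter> h e)" using \<open>A \<in> \<A>\<close> by (auto simp: F_def)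
      then show ?thesis by (rule finite_subset[rotated]) blast
    qed
  qed simp
  then have "B \<subseteq>* e \<or> B \<subseteq>* UNIV - e" if "e \<in> S" for e
  proof -
    have "B \<inter> h e = B - (UNIV - e) \<or> B \<inter> h e = B - e"
      using B(2) by (auto simp: h_def)
    then show ?thesis
      using \<open>\<And>e. e \<in> S \<Longrightarrow> finite (B \<inter> h e)\<close>[OF that] by (auto simp: almost_subset_def)
  qed
  then show False
    using S(1) B(1) by (auto simp: splitting_family_def infinite_subsets_def)
qed

section \<open>Types of positive sets\<close>
locale ordered_splitting_family =
  fixes S :: "nat set set" and less :: "nat set \<Rightarrow> nat set \<Rightarrow> bool"  (infix \<open>\<prec>\<close> 50)
  assumes splitting: "splitting_family S" and small: "|S| <o \<aa>\<^sub>*"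
    and wf_prec: "wf {(x, y). x \<prec> y}"
    and prec_linear: "x \<noteq> y \<Longrightarrow> x \<prec> y \<or> y \<prec> x"
begin

definition first_split :: "nat set set \<Rightarrow> nat set \<Rightarrow> nat set"
  where "first_split \<A> b =
    (SOME e. e \<in> S \<and> splits \<A> e b \<and> (\<forall>e'\<in>S. e' \<prec> e \<longrightarrow> \<not> splits \<A> e' b))"

lemma first_split:
  assumes "pairwise almost_disjoint \<A>" "b \<notin> id_ideal \<A>"
  shows "first_split \<A> b \<in> S" "splits \<A> (first_split \<A> b) b"
    and "\<And>e. e \<in> S \<Longrightarrow> e \<prec> first_split \<A> b \<Longrightarrow> \<not> splits \<A> e b"
proof -
  obtain e0 where "e0 \<in> {e \<in> S. splits \<A> e b}"
    using positive_split[OF assms splitting small] by blast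
  then have "\<exists>e. e \<in> S \<and> splits \<A> e b \<and> (\<forall>e'\<in>S. e' \<prec> e \<longrightarrow> \<not> splits \<A> e' b)"
    using wfE_min[OF wf_prec, of e0 "{e \<in> S. splits \<A> e b}"] by (metis (no_types, lifting) case_prodI mem_Collect_eq)
  from someI_ex[OF this, folded first_split_def]
  show "first_split \<A> b \<in> S" "splits \<A> (first_split \<A> b) b"
    and "\<And>e. e \<in> S \<Longrightarrow> e \<prec> first_split \<A> b \<Longrightarrow> \<not> splits \<A> e b"
    by blast+
qed

lemma first_split_infinite:
  assumes "infinite a"
  shows "first_split {} a \<in> S" "splits {} (first_split {} a) a"
    and "\<And>e. e \<in> S \<Longrightarrow> e \<prec> first_split {} a \<Longrightarrow> \<not> splits {} e a"
  using first_split[of "{}" a] assms by (auto simp: id_ideal_empty)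

lemma prec_trans: "x \<prec> y \<Longrightarrow> y \<prec> z \<Longrightarrow> x \<prec> z"
proof -
  assume xy: "x \<prec> y" "y \<prec> z"
  obtain m where m: "m \<in> {x, y, z}" "\<And>w. w \<prec> m \<Longrightarrow> w \<notin> {x, y, z}"
    using wfE_min[OF wf_prec, of x "{x, y, z}"] by auto
  then have "m = x" using xy by auto
  then show "x \<prec> z" using m(2)[of x] m(2)[of y] m(2)[of z] xy prec_linear[of x z] by auto
qed

text \<open>
  The type of \<open>b\<close> relative to \<open>\<A>\<close> assigns to each \<open>e\<close> before \<open>first_split \<A> b\<close> the side of \<open>e\<close> in
  which \<open>b\<close> is positive. That \<open>a\<close> conforms at \<open>e\<close> means that \<open>a\<close> is almost contained in this side, and
  that \<open>a\<close> follows \<open>b\<close> means that the type of \<open>a\<close> extends the type of \<open>b\<close>.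
\<close>
definition conforms :: "nat set set \<Rightarrow> nat set \<Rightarrow> nat set \<Rightarrow> nat set \<Rightarrow> bool"
  where "conforms \<A> b a e \<longleftrightarrow> (if b - e \<in> id_ideal \<A> then finite (a - e) else finite (a \<inter> e))"

definition follows :: "nat set set \<Rightarrow> nat set \<Rightarrow> nat set \<Rightarrow> bool"
  where "follows \<A> b a \<longleftrightarrow> (\<forall>e\<in>S. e \<prec> first_split \<A> b \<longrightarrow> conforms \<A> b a e)"

section \<open>The tree of positive sets\<close>
primrec branch :: "nat set set \<Rightarrow> nat set \<Rightarrow> nat set \<Rightarrow> nat \<Rightarrow> nat set"
  where "branch \<A> b F 0 = b"
  | "branch \<A> b F (Suc n) =
      (if n \<in> F then branch \<A> b F n \<inter> first_split \<A> (branch \<A> b F n)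
       else branch \<A> b F n - first_split \<A> (branch \<A> b F n))"

lemma branch_cong:
  "(\<And>k. k < n \<Longrightarrow> k \<in> F \<longleftrightarrow> k \<in> G) \<Longrightarrow> branch \<A> b F n = branch \<A> b G n"
  by (induction n) auto

lemma branch_positive:
  assumes "pairwise almost_disjoint \<A>" "b \<notin> id_ideal \<A>"
  shows "branch \<A> b F n \<notin> id_ideal \<A>"
proof (induction n)
  case (Suc n)
  show ?case using first_split(2)[OF assms(1) Suc] by (auto simp: splits_def)
qed (use assms in simp)

lemma branch_decseq: "decseq (branch \<A> b F)"
  by (rule decseq_SucI) auto

text \<open>
  Positive subsets are split by fewer elements of \<open>S\<close>, so the first split can only move up, and it
  does move once \<open>P\<close> is on one side of the old one.
\<close>
lemma first_split_increases:
  assumes ad: "pairwise almost_disjoint \<A>" and pos: "c \<notin> id_ideal \<A>" "P \<notin> id_ideal \<A>"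
    and "finite (P - c)" and "P \<inter> first_split \<A> c \<in> id_ideal \<A> \<or> P - first_split \<A> c \<in> id_ideal \<A>"
  shows "first_split \<A> c \<prec> first_split \<A> P"
proof -
  have "\<not> splits \<A> (first_split \<A> c) P"
    using assms(5) by (auto simp: splits_def)
  then have "first_split \<A> c \<noteq> first_split \<A> P"
    using first_split(2)[OF ad pos(2)] by auto
  moreover have "\<not> first_split \<A> P \<prec> first_split \<A> c"
    using first_split(3)[OF ad pos(1) first_split(1)[OF ad pos(2)]]
      splits_almost_subset[OF first_split(2)[OF ad pos(2)] assms(4)] by blast
  ultimately show ?thesis using prec_linear by blast
qed

text \<open>
  Let \<open>P F\<close> be a positive pseudo-intersection of the branch \<open>F \<subseteq> \<omega>\<close>. Two branches that part at a
  node \<open>c\<close> are on opposite sides of \<open>first_split \<A> c\<close>, an element that precedes the first splits of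
  both pseudo-intersections; so no infinite set follows both. If each \<open>P F\<close> were followed by a member,
  \<open>\<A>\<close> would have at least continuum many members.
\<close>
lemma unfollowed_positive:
  assumes ad: "pairwise almost_disjoint \<A>" and inf: "\<And>a. a \<in> \<A> \<Longrightarrow> infinite a"
    and card: "|\<A>| <o |UNIV :: nat set set|" and b: "b \<notin> id_ideal \<A>"
  obtains P where "P \<notin> id_ideal \<A>" "P \<subseteq> b" "\<And>a. a \<in> \<A> \<Longrightarrow> \<not> follows \<A> P a"
proof -
  have "\<exists>P. P \<notin> id_ideal \<A> \<and> P \<subseteq> b \<and> (\<forall>n. finite (P - branch \<A> b F n))" for F
    using positive_pseudo_intersection[OF ad branch_decseq branch_positive[OF ad b]]
    by (metis branch.simps(1))
  then obtain P where P: "\<And>F. P F \<notin> id_ideal \<A>" "\<And>F. P F \<subseteq> b"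
    "\<And>F n. finite (P F - branch \<A> b F n)" by metis
  have "\<exists>F. \<forall>a\<in>\<A>. \<not> follows \<A> (P F) a"
  proof (rule ccontr)
    assume "\<not> ?thesis"
    then obtain g where g: "\<And>F. g F \<in> \<A>" "\<And>F. follows \<A> (P F) (g F)" by metis
    have "F = G" if eq: "g F = g G" for F G
    proof (rule ccontr)
      assume "F \<noteq> G"
      have *: False if gFG: "g F = g G" and n: "n \<in> F" "n \<notin> G" "\<And>k. k < n \<Longrightarrow> k \<in> F \<longleftrightarrow> k \<in> G" for F G n
      proof -
        define c where "c = branch \<A> b F n"
        have cG: "c = branch \<A> b G n" unfolding c_def by (rule branch_cong) (rule n(3))
        let ?e = "first_split \<A> c"
        have c: "c \<notin> id_ideal \<A>" unfolding c_def by (rule branch_positive[OF ad b])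
        have e: "?e \<in> S" by (rule first_split(1)[OF ad c])
        have Pc: "finite (P F - c)" "finite (P G - c)"
          using P(3)[of F n] P(3)[of G n] by (auto simp: c_def[symmetric] cG[symmetric])
        have "finite (P F - (c \<inter> ?e))" "finite (P G - (c - ?e))"
          using P(3)[of F "Suc n"] P(3)[of G "Suc n"] n(1,2)
          by (auto simp: c_def[symmetric] cG[symmetric])
        then have "finite (P F - ?e)" "finite (P G \<inter> ?e)"
          by (auto elim: finite_subset[rotated])
        then have I: "P F - ?e \<in> id_ideal \<A>" "P G \<inter> ?e \<in> id_ideal \<A>"
          by (auto intro: finite_in_id_ideal)
        have "?e \<prec> first_split \<A> (P F)" "?e \<prec> first_split \<A> (P G)"
          using first_split_increases[OF ad c P(1)] Pc I by blast+
        then have conf: "conforms \<A> (P F) (g F) ?e" "conforms \<A> (P G) (g F) ?e"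
          using g(2)[of F] g(2)[of G] e by (auto simp: follows_def gFG)
        have "P G - ?e \<notin> id_ideal \<A>"
        proof
          assume "P G - ?e \<in> id_ideal \<A>"
          then have "(P G \<inter> ?e) \<union> (P G - ?e) \<in> id_ideal \<A>" by (rule id_ideal_Un[OF I(2)])
          then show False using P(1)[of G] by (simp add: Int_Diff_Un)
        qed
        then have "finite (g F - ?e)" "finite (g F \<inter> ?e)"
          using conf I(1) by (auto simp: conforms_def)
        then have "finite (g F)" by (metis Int_Diff_Un finite_Un)
        then show False using inf g(1) by blast
      qed
      define n where "n = (LEAST n. (n \<in> F) \<noteq> (n \<in> G))"
      have "\<exists>n. (n \<in> F) \<noteq> (n \<in> G)" using \<open>F \<noteq> G\<close> by blast
      then have "(n \<in> F) \<noteq> (n \<in> G)" unfolding n_def by (rule LeastI_ex)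
      moreover have "k \<in> F \<longleftrightarrow> k \<in> G" if "k < n" for k
        using not_less_Least[OF that[unfolded n_def]] by simp
      ultimately show False using *[of F G n] *[of G F n] eq by metis
    qed
    then have "inj g" by (rule injI)
    then have "|UNIV :: nat set set| \<le>o |\<A>|"
      using g(1) by (intro card_of_ordLeqI[of g]) auto
    then show False using card not_ordLess_ordLeq by blast
  qed
  then show thesis using that P(1,2) by blast
qed

section \<open>Adding one member\<close>

text \<open>Types are compared here as those of infinite sets, that is, relative to the empty family.\<close>
definition same_type :: "nat set \<Rightarrow> nat set \<Rightarrow> bool"
  where "same_type a a' \<longleftrightarrow> first_split {} a = first_split {} a' \<and>
    (\<forall>e\<in>S. e \<prec> first_split {} a \<longrightarrow> (finite (a - e) \<longleftrightarrow> finite (a' - e)))"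

definition separated :: "nat set \<Rightarrow> nat set \<Rightarrow> bool"
  where "separated a a' \<longleftrightarrow> almost_disjoint a a' \<and> \<not> same_type a a'"

lemma separated_sym: "separated a a' \<Longrightarrow> separated a' a"
  unfolding separated_def same_type_def almost_disjoint_def
  by (auto simp: Int_commute)

text \<open>
  Charge each member \<open>a\<close> that meets \<open>P\<close> to the first \<open>e\<close> at which it does not conform to \<open>P\<close>. If \<open>e\<close>
  does not split \<open>a\<close>, then \<open>a\<close> is almost contained in the wrong side, so it meets the part \<open>h e\<close> of \<open>P\<close>,
  which lies in the ideal: this is \<open>F1\<close>. If \<open>e\<close> splits \<open>a\<close>, the type of \<open>a\<close> is that of \<open>P\<close> cut off at
  \<open>e\<close>, and only one member has this type: this is \<open>F2\<close>.
\<close>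
lemma unfollowed_meets_few:
  assumes ind: "pairwise separated \<A>" and inf: "\<And>a. a \<in> \<A> \<Longrightarrow> infinite a"
    and P: "P \<notin> id_ideal \<A>" "\<And>a. a \<in> \<A> \<Longrightarrow> \<not> follows \<A> P a"
  obtains F where "\<And>e. e \<in> S \<Longrightarrow> finite (F e)" "{a \<in> \<A>. infinite (a \<inter> P)} \<subseteq> (\<Union>e\<in>S. F e)"
proof -
  have ad: "pairwise almost_disjoint \<A>"
    using ind by (auto simp: pairwise_def separated_def)
  let ?d = "first_split \<A> P"
  define h where "h e = (if P - e \<in> id_ideal \<A> then P - e else P \<inter> e)" for e
  have h: "h e \<in> id_ideal \<A>" if "e \<in> S" "e \<prec> ?d" for e
    using first_split(3)[OF ad P(1) that] by (auto simp: h_def splits_def)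
  define F1 where "F1 e = {a \<in> \<A>. e \<prec> ?d \<and> infinite (a \<inter> h e)}" for e
  define F2 where "F2 e = {a \<in> \<A>. e \<prec> ?d \<and> first_split {} a = e \<and>
    (\<forall>e'\<in>S. e' \<prec> e \<longrightarrow> conforms \<A> P a e')}" for e
  have "finite (F1 e)" if "e \<in> S" for e
  proof (cases "e \<prec> ?d")
    case True
    show ?thesis
      using id_ideal_finite_meets[OF ad h[OF that True]] by (rule finite_subset[rotated]) (auto simp: F1_def)
  qed (simp add: F1_def)
  moreover have "finite (F2 e)" for e
  proof -
    have "a = a'" if "a \<in> F2 e" "a' \<in> F2 e" for a a'
    proof (rule ccontr)
      assume "a \<noteq> a'"
      then have "\<not> same_type a a'"
        using ind that by (auto simp: pairwise_def separated_def F2_def)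
      moreover have aa: "infinite a" "infinite a'" using that inf by (auto simp: F2_def)
      have "finite (a - e') \<longleftrightarrow> finite (a' - e')" if e': "e' \<in> S" "e' \<prec> e" for e'
      proof -
        have "conforms \<A> P a e'" "conforms \<A> P a' e'"
          using \<open>a \<in> F2 e\<close> \<open>a' \<in> F2 e\<close> e' by (auto simp: F2_def)
        moreover have "infinite (a \<inter> e') \<or> infinite (a - e')" "infinite (a' \<inter> e') \<or> infinite (a' - e')"
          using aa by (metis Int_Diff_Un finite_Un)+
        ultimately show ?thesis by (auto simp: conforms_def split: if_splits)
      qed
      ultimately show False using that by (auto simp: same_type_def F2_def)
    qed
    then have "F2 e \<subseteq> {SOME a. a \<in> F2 e}" by (metis someI singletonI subsetI)
    then show ?thesis using finite_subset by blast
  qed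
  ultimately have "finite (F1 e \<union> F2 e)" if "e \<in> S" for e using that by blast
  moreover have "a \<in> (\<Union>e\<in>S. F1 e \<union> F2 e)" if a: "a \<in> \<A>" "infinite (a \<inter> P)" for a
  proof -
    let ?N = "{e \<in> S. e \<prec> ?d \<and> \<not> conforms \<A> P a e}"
    obtain e0 where "e0 \<in> ?N"
      using P(2)[OF a(1)] by (auto simp: follows_def)
    then obtain e where e: "e \<in> ?N" and least: "\<And>e'. e' \<prec> e \<Longrightarrow> e' \<notin> ?N"
      using wfE_min[OF wf_prec, of e0 ?N] by auto
    have conf: "conforms \<A> P a e'" if "e' \<in> S" "e' \<prec> e" for e'
      using least[OF that(2)] that prec_trans[of e' e ?d] e by auto
    have nsp: "\<not> splits {} e' a" if "e' \<in> S" "e' \<prec> e" for e'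
      using conf[OF that] by (auto simp: conforms_def splits_def id_ideal_empty split: if_splits)
    show ?thesis
    proof (cases "splits {} e a")
      case True
      have ia: "infinite a" using inf a by blast
      have "first_split {} a = e"
        using prec_linear[of "first_split {} a" e] first_split_infinite[OF ia] nsp True e by blast
      then have "a \<in> F2 e" using a e conf by (auto simp: F2_def)
      then show ?thesis using e by blast
    next
      case False
      have "finite (a \<inter> P - h e)"
      proof (cases "P - e \<in> id_ideal \<A>")
        case True
        then have "infinite (a - e)" using e by (auto simp: conforms_def)
        then have "finite (a \<inter> e)" using False by (auto simp: splits_def id_ideal_empty)
        then show ?thesis by (rule finite_subset[rotated]) (auto simp: h_def True)
      next
        case notI: False
        then have "infinite (a \<inter> e)" using e by (auto simp: conforms_def)
        then have "finite (a - e)" using False by (auto simp: splits_def id_ideal_empty)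
        then show ?thesis by (rule finite_subset[rotated]) (auto simp: h_def notI)
      qed
      moreover have "a \<inter> P \<subseteq> (a \<inter> h e) \<union> (a \<inter> P - h e)" by blast
      ultimately have "infinite (a \<inter> h e)"
        using a(2) by (meson finite_Un finite_subset)
      then have "a \<in> F1 e" using a e by (auto simp: F1_def)
      then show ?thesis using e by blast
    qed
  qed
  then have "{a \<in> \<A>. infinite (a \<inter> P)} \<subseteq> (\<Union>e\<in>S. F1 e \<union> F2 e)" by blast
  ultimately show thesis using that[of "\<lambda>e. F1 e \<union> F2 e"] by blast
qed

text \<open>
  The new set \<open>a\<close> is almost disjoint from all members, hence almost disjoint from the parts of \<open>P\<close> in
  the ideal, which is why it follows \<open>P\<close>. A member with the same type as \<open>a\<close> would also follow \<open>P\<close>.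
\<close>
lemma extend_separated:
  assumes ind: "pairwise separated \<A>" and inf: "\<And>a. a \<in> \<A> \<Longrightarrow> infinite a"
    and card: "|\<A>| <o |UNIV :: nat set set|" and b: "b \<notin> id_ideal \<A>"
    and J: "dense_family J"
  obtains a where "a \<in> J" "a \<subseteq> b" "\<And>a'. a' \<in> \<A> \<Longrightarrow> separated a a'"
proof -
  have ad: "pairwise almost_disjoint \<A>"
    using ind by (auto simp: pairwise_def separated_def)
  obtain P where P: "P \<notin> id_ideal \<A>" "P \<subseteq> b" "\<And>a. a \<in> \<A> \<Longrightarrow> \<not> follows \<A> P a"
    using unfollowed_positive[OF ad inf card b] by blast
  obtain F where F: "\<And>e. e \<in> S \<Longrightarrow> finite (F e)" "{a \<in> \<A>. infinite (a \<inter> P)} \<subseteq> (\<Union>e\<in>S. F e)"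
    using unfollowed_meets_few[OF ind inf P(1,3)] by blast
  obtain B where B: "infinite B" "B \<subseteq> P" "\<And>A. A \<in> {a \<in> \<A>. infinite (a \<inter> P)} \<Longrightarrow> finite (B \<inter> A)"
    using positive_escapes_small[OF ad P(1) small _ F(2) F(1)] by blast
  obtain a where a: "a \<in> J" "a \<subseteq> B"
    using J B(1) by (auto simp: dense_family_def infinite_subsets_def)
  have ia: "infinite a" using a(1) J by (auto simp: dense_family_def infinite_subsets_def)
  have aA: "finite (a \<inter> A)" if "A \<in> \<A>" for A
  proof (cases "infinite (A \<inter> P)")
    case True
    then have "finite (B \<inter> A)" using B(3) that by blast
    then show ?thesis by (rule finite_subset[rotated]) (use a in blast)
  next
    case False
    then have "finite (A \<inter> P)" by simp
    then show ?thesis by (rule finite_subset[rotated]) (use a B in blast)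
  qed
  have aI: "finite (a \<inter> X)" if "P \<inter> X \<in> id_ideal \<A>" for X
    using id_ideal_almost_disjoint_finite[OF that, of "a \<inter> X"] a(2) B(2) aA
    by (meson Int_lower1 Int_mono finite_subset order_refl order_trans)
  let ?d = "first_split \<A> P"
  have conf: "conforms \<A> P a e" if e: "e \<in> S" "e \<prec> ?d" for e
  proof (cases "P - e \<in> id_ideal \<A>")
    case True
    then show ?thesis using aI[of "- e"] by (simp add: conforms_def Diff_eq)
  next
    case False
    then have "P \<inter> e \<in> id_ideal \<A>" using first_split(3)[OF ad P(1) e] by (auto simp: splits_def)
    then show ?thesis using aI[of e] False by (simp add: conforms_def)
  qed
  let ?f = "first_split {} a"
  have "\<not> splits {} e a" if "e \<in> S" "e \<prec> ?d" for e
    using conf[OF that] by (auto simp: conforms_def splits_def id_ideal_empty split: if_splits)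
  then have "\<not> ?f \<prec> ?d" using first_split_infinite[OF ia] by blast
  then have below: "e \<prec> ?f" if "e \<prec> ?d" for e
    using that prec_linear[of ?f ?d] prec_trans[of e ?d ?f] by metis
  have "\<not> same_type a a'" if a': "a' \<in> \<A>" for a'
  proof
    assume same: "same_type a a'"
    have "conforms \<A> P a' e" if e: "e \<in> S" "e \<prec> ?d" for e
    proof -
      have "e \<prec> ?f" using below e by blast
      then have "finite (a - e) \<longleftrightarrow> finite (a' - e)" "\<not> splits {} e a'"
        using same e first_split_infinite(3)[OF inf[OF a'] e(1)] by (auto simp: same_type_def)
      moreover have "infinite (a \<inter> e) \<or> infinite (a - e)"
        using ia by (metis Int_Diff_Un finite_Un)
      ultimately show ?thesis
        using conf[OF e] by (auto simp: conforms_def splits_def id_ideal_empty split: if_splits)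
    qed
    then show False using P(3)[OF a'] by (auto simp: follows_def)
  qed
  then have "separated a a'" if "a' \<in> \<A>" for a'
    using that aA by (auto simp: separated_def almost_disjoint_def)
  then show thesis using that a B(2) P(2) by blast
qed

end

section \<open>The recursion\<close>

text \<open>
  Maximality is a special case of saturation: an infinite set almost disjoint from all members is
  positive, so it would contain a member.
\<close>
lemma saturated_MADI:
  assumes "AD \<A>" and sat: "\<And>B. B \<notin> id_ideal \<A> \<Longrightarrow> \<exists>A\<in>\<A>. A \<subseteq> B"
  shows "saturated_MAD \<A>"
proof -
  have "\<B> = \<A>" if \<B>: "AD \<B>" "\<A> \<subseteq> \<B>" for \<B>
  proof (rule ccontr)
    assume "\<B> \<noteq> \<A>"
    then obtain X where X: "X \<in> \<B>" "X \<notin> \<A>" using \<B>(2) by blast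
    have fin: "finite (X \<inter> A)" if "A \<in> \<A>" for A
      using \<B> X that pairwiseD[of almost_disjoint \<B> X A] by (auto simp: AD_def almost_disjoint_def)
    moreover have "infinite X" using \<B>(1) X(1) by (auto simp: AD_def infinite_subsets_def)
    ultimately have "X \<notin> id_ideal \<A>" using id_ideal_almost_disjoint_finite[of X \<A> X] by blast
    then obtain A where A: "A \<in> \<A>" "A \<subseteq> X" using sat by blast
    then have "finite A" using fin[of A] by (simp add: Int_absorb1)
    then show False using A(1) assms(1) by (auto simp: AD_def infinite_subsets_def)
  qed
  moreover have "\<exists>A\<in>\<A>. A \<subseteq>* B" if B: "B \<in> id_plus \<A>" for B
  proof -
    obtain A where "A \<in> \<A>" "A \<subseteq> B" using B sat[of B] unfolding id_plus_def by blast
    moreover from this have "A - B = {}" by blast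
    ultimately show ?thesis by (metis almost_subset_def finite.emptyI)
  qed
  ultimately show ?thesis using assms(1) by (auto simp: saturated_MAD_def MAD_def)
qed

text \<open>
  The recursion by itself might end with a finite family, for instance with \<open>{\<omega>}\<close>. To prevent this,
  only those elements of \<open>J\<close> are used that meet at most one of countably many fixed, pairwise almost
  disjoint sets \<open>C n\<close> in an infinite set: finitely many such elements leave some \<open>C n\<close> positive. The sets \<open>C n\<close> can be
  taken from any sequence as in the definition of \<open>\<aa>\<^sub>*\<close>.
\<close>
lemma dense_family_uncovering:
  assumes J: "dense_family J"
  obtains J' C where "dense_family J'" "J' \<subseteq> J" "\<And>n::nat. infinite (C n)"
    "\<And>a. a \<in> J' \<Longrightarrow> finite {n. infinite (a \<inter> C n)}"
proof -
  obtain A where A: "a_star_sequence \<aa>\<^sub>* A" using a_star(2) by blast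
  define C where "C n = A (Inr n)" for n
  have C_inf: "infinite (C n)" for n
    using A by (auto simp: a_star_sequence_def infinite_subsets_def C_def)
  have C_ad: "finite (C m \<inter> C n)" if "m \<noteq> n" for m n
    using A pairwiseD[of _ _ "Inr m" "Inr n"] that
    unfolding a_star_sequence_def almost_disjoint_def C_def by blast
  define J' where "J' = {a \<in> J. (\<exists>n. a \<subseteq> C n) \<or> (\<forall>n. finite (a \<inter> C n))}"
  show thesis
  proof
    have "\<exists>a\<in>J'. a \<subseteq> B" if B: "infinite B" for B
    proof (cases "\<exists>n. infinite (B \<inter> C n)")
      case True
      then obtain n where "infinite (B \<inter> C n)" by blast
      then obtain a where "a \<in> J" "a \<subseteq> B \<inter> C n"
        using J by (auto simp: dense_family_def infinite_subsets_def)
      then show ?thesis by (auto simp: J'_def)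
    next
      case False
      obtain a where a: "a \<in> J" "a \<subseteq> B" using J B by (auto simp: dense_family_def infinite_subsets_def)
      have "finite (a \<inter> C n)" for n
        using False a(2) by (meson Int_mono finite_subset order_refl)
      then show ?thesis using a by (auto simp: J'_def)
    qed
    then show "dense_family J'" using J by (auto simp: dense_family_def infinite_subsets_def J'_def)
    show "J' \<subseteq> J" by (auto simp: J'_def)
    show "infinite (C n)" for n by (rule C_inf)
    fix a assume "a \<in> J'"
    then consider m where "a \<subseteq> C m" | "\<forall>n. finite (a \<inter> C n)" by (auto simp: J'_def)
    then show "finite {n. infinite (a \<inter> C n)}"
    proof cases
      case 1
      have "finite (a \<inter> C n)" if "n \<noteq> m" for n
        by (rule finite_subset[OF _ C_ad[of m n]]) (use that 1 in auto)
      then have "{n. infinite (a \<inter> C n)} \<subseteq> {m}" by blast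
      then show ?thesis using finite_subset by blast
    qed simp
  qed
qed

lemma card_of_UNIV_strict_linear:
  fixes x y :: 'a
  assumes "x \<noteq> y"
  shows "(x, y) \<in> |UNIV :: 'a set| - Id \<or> (y, x) \<in> |UNIV :: 'a set| - Id"
  using card_of_Well_order[of "UNIV :: 'a set"] assms
  by (auto simp: well_order_on_def linear_order_on_def total_on_def Field_card_of)

text \<open>
  The recursion runs along a well-order of all sets in which each one has fewer than continuum many
  predecessors. Its value at \<open>x\<close> is the new member contained in \<open>x\<close>, or \<open>{}\<close> if \<open>x\<close> is not positive at
  that stage; \<open>{}\<close> is not an element of \<open>J'\<close>, so it can be removed again.
\<close>
lemma (in ordered_splitting_family) exists_saturated_MAD:
  assumes J: "dense_family J"
  obtains \<A> where "saturated_MAD \<A>" "\<A> \<subseteq> J"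
proof -
  obtain J' C where J': "dense_family J'" "J' \<subseteq> J" and C: "\<And>n::nat. infinite (C n)"
    and JC: "\<And>a. a \<in> J' \<Longrightarrow> finite {n. infinite (a \<inter> C n)}"
    using dense_family_uncovering[OF J] by metis
  have J'_inf: "infinite a" if "a \<in> J'" for a
    using that J'(1) by (auto simp: dense_family_def infinite_subsets_def)
  let ?r = "|UNIV :: nat set set|"
  have Cr: "Card_order ?r" by (rule card_of_Card_order)
  have wo: "Well_order ?r" by (rule card_of_Well_order)
  define R where "R = ?r - Id"
  have wf_R: "wf R" unfolding R_def using wo by (auto simp: well_order_on_def)
  have tot: "(x, y) \<in> R \<or> (y, x) \<in> R" if "x \<noteq> y" for x y
    unfolding R_def using that by (rule card_of_UNIV_strict_linear)
  define prev where "prev f x = f ` {z. (z, x) \<in> R} - {{}}" for f :: "nat set \<Rightarrow> nat set" and x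
  define Q where "Q f x a \<longleftrightarrow> (if x \<in> id_ideal (prev f x) then a = {}
      else a \<in> J' \<and> a \<subseteq> x \<and> (\<forall>a'\<in>prev f x. separated a a'))" for f x a
  have pw: "pairwise separated (f ` M - {{}})"
    if Qf: "\<And>y. y \<in> M \<Longrightarrow> Q f y (f y)" for f M
    unfolding pairwise_def
  proof (intro ballI impI)
    have *: "separated (f y) (f z)" if "y \<in> M" "z \<in> M" "f y \<noteq> {}" "f z \<noteq> {}" "(z, y) \<in> R" for y z
    proof -
      have "f z \<in> prev f y" using that by (auto simp: prev_def)
      then show ?thesis using Qf[OF that(1)] that(3) by (auto simp: Q_def split: if_splits)
    qed
    fix a a' assume "a \<in> f ` M - {{}}" "a' \<in> f ` M - {{}}" "a \<noteq> a'"
    then obtain y z where "y \<in> M" "z \<in> M" "a = f y" "a' = f z" "f y \<noteq> {}" "f z \<noteq> {}" "y \<noteq> z" by blast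
    then show "separated a a'" using * tot separated_sym by metis
  qed
  have QJ: "f ` M - {{}} \<subseteq> J'" if "\<And>y. y \<in> M \<Longrightarrow> Q f y (f y)" for f M
    using that by (fastforce simp: Q_def split: if_splits)
  have "\<exists>f. \<forall>x. Q f x (f x)"
  proof (rule dependent_wf_choice[OF wf_R])
    fix f g :: "nat set \<Rightarrow> nat set" and x r
    assume "\<And>z. (z, x) \<in> R \<Longrightarrow> f z = g z"
    then have "prev f x = prev g x" by (force simp: prev_def)
    then show "Q f x r = Q g x r" by (simp add: Q_def)
  next
    fix x f assume IH: "\<And>y. (y, x) \<in> R \<Longrightarrow> Q f y (f y)"
    have "pairwise separated (prev f x)" unfolding prev_def by (rule pw) (use IH in blast)
    moreover have "prev f x \<subseteq> J'" unfolding prev_def by (rule QJ) (use IH in blast)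
    moreover have "|prev f x| <o ?r"
    proof -
      have "|prev f x| \<le>o |f ` {z. (z, x) \<in> R}|" unfolding prev_def by (rule card_of_mono1) blast
      also have "|f ` {z. (z, x) \<in> R}| \<le>o |{z. (z, x) \<in> R}|" by (rule card_of_image)
      also have "{z. (z, x) \<in> R} = underS ?r x" by (auto simp: R_def underS_def)
      also have "|underS ?r x| <o ?r" by (rule card_of_underS[OF Cr]) (simp add: Field_card_of)
      finally show ?thesis .
    qed
    ultimately show "\<exists>a. Q f x a"
      using extend_separated[of "prev f x" x J'] J'(1) J'_inf unfolding Q_def by (metis subsetD)
  qed
  then obtain f where f: "\<And>x. Q f x (f x)" by blast
  define \<A> where "\<A> = range f - {{}}"
  have "pairwise separated \<A>" unfolding \<A>_def by (rule pw) (rule f)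
  then have ad: "pairwise almost_disjoint \<A>" by (auto simp: pairwise_def separated_def)
  have \<A>J: "\<A> \<subseteq> J'" unfolding \<A>_def by (rule QJ) (rule f)
  have sat: "\<exists>A\<in>\<A>. A \<subseteq> B" if "B \<notin> id_ideal \<A>" for B
  proof -
    have "prev f B \<subseteq> \<A>" by (auto simp: prev_def \<A>_def)
    then have "B \<notin> id_ideal (prev f B)" using that id_ideal_mono by blast
    then have "f B \<in> J'" "f B \<subseteq> B" using f[of B] by (auto simp: Q_def)
    moreover from this have "f B \<noteq> {}" using J'_inf by force
    ultimately show ?thesis by (auto simp: \<A>_def)
  qed
  have "infinite \<A>"
  proof
    assume fin: "finite \<A>"
    have "finite (\<Union>a\<in>\<A>. {n. infinite (a \<inter> C n)})" using fin JC \<A>J by blast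
    then obtain n where "n \<notin> (\<Union>a\<in>\<A>. {n. infinite (a \<inter> C n)})"
      using ex_new_if_finite infinite_UNIV_nat by metis
    then have n: "finite (C n \<inter> a)" if "a \<in> \<A>" for a using that by (auto simp: Int_commute)
    then have "C n \<notin> id_ideal \<A>" using C id_ideal_almost_disjoint_finite[of "C n" \<A> "C n"] by blast
    then obtain a where a: "a \<in> \<A>" "a \<subseteq> C n" using sat by blast
    then have "finite a" using n[of a] by (simp add: Int_absorb1)
    then show False using J'_inf \<A>J a by blast
  qed
  then have "AD \<A>" using ad \<A>J J'_inf by (auto simp: AD_def infinite_subsets_def)
  then have "saturated_MAD \<A>" using sat by (rule saturated_MADI)
  then show thesis using that \<A>J J'(2) by blast
qed

theorem theorem1p1:
  assumes "\<ss> <o \<aa>\<^sub>*"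
  shows "(\<exists>\<A>. saturated_MAD \<A>) \<and>
    (\<forall>J. dense_family J \<longrightarrow> (\<exists>\<A>. saturated_MAD \<A> \<and> \<A> \<subseteq> J))"
proof -
  obtain S where S: "splitting_family S" "|S| =o \<ss>" using splitting_number(1) by blast
  let ?r = "|UNIV :: nat set set|"
  have wo: "Well_order ?r" by (rule card_of_Well_order)
  interpret ordered_splitting_family S "\<lambda>x y. (x, y) \<in> ?r - Id"
  proof
    show "|S| <o \<aa>\<^sub>*" using S(2) assms by (rule ordIso_ordLess_trans)
    have "{(x, y). (x, y) \<in> ?r - Id} = ?r - Id" by auto
    then show "wf {(x, y). (x, y) \<in> ?r - Id}" using wo by (simp add: well_order_on_def)
    show "(x, y) \<in> ?r - Id \<or> (y, x) \<in> ?r - Id" if "x \<noteq> y" for x y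
      using that by (rule card_of_UNIV_strict_linear)
  qed (rule S(1))
  have "dense_family infinite_subsets" by (auto simp: dense_family_def)
  then show ?thesis using exists_saturated_MAD by metis
qed

end
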